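(* Let $N\ge 1$ be an integer. For $H=(h_{j,\ell})_{j,\ell=1}^N\in\mathbb{C}^{N\times N}$ put $\|H\|_\infty=\max_{1\le j,\ell\le N}|h_{j,\ell}|$, and let $B=\{H\in\mathbb{C}^{N\times N}:\|H\|_\infty<\frac1N\}$. (i) The series $$\sum_{K}\Big(\prod_{1\le m,n\le N}\frac{(h_{m,n})^{k_{m,n}}}{k_{m,n}!}\Big)H_{r_1,c_1}(\overline{w_1},w_1)\cdots H_{r_N,c_N}(\overline{w_N},w_N)$$ converges absolutely and uniformly for $W=(w_1,\dots,w_N)^T$ in any compact subset of $\mathbb{C}^N$ and $H$ in any compact subset of $B$. (ii) Let $\delta=(\delta_{j,k})_{j,k=1}^N$ with all $\delta_{j,k}>0$, and let $H_0=(h^{(0)}_{j,k})_{j,k=1}^N\in B$ be a Hermitian matrix. Let $D(H_0,\delta)$ be the set of all $H\in\mathbb{C}^{N\times N}$ such that $$|h_{j,j}-h^{(0)}_{j,j}|<\delta_{j,j}\ (1\le j\le N),\qquad |u_{\ell,k}-u^{(0)}_{\ell,k}|<\delta_{\ell,k},\quad |v_{\ell,k}-v^{(0)}_{\ell,k}|<\delta_{\ell,k}\ (1\le \ell<k\le N),$$ where $$u_{\ell,k}=\frac{h_{\ell,k}+h_{k,\ell}}2,\quad v_{\ell,k}=\frac{h_{\ell,k}-h_{k,\ell}}{2i},\quad u^{(0)}_{\ell,k}=\frac{h^{(0)}_{\ell,k}+h^{(0)}_{k,\ell}}2,\quad v^{(0)}_{\ell,k}=\frac{h^{(0)}_{\ell,k}-h^{(0)}_{k,\ell}}{2i}.$$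 If $D(H_0,\delta)\subset B$, then $$\exp\left(W^*H(I_N+H)^{-1}W\right)=\det(I_N+H)\sum_{K}\Big(\prod_{1\le m,n\le N}\frac{(h_{m,n})^{k_{m,n}}}{k_{m,n}!}\Big)H_{r_1,c_1}(\overline{w_1},w_1)\cdots H_{r_N,c_N}(\overline{w_N},w_N)$$ holds for all $W\in\mathbb{C}^N$ and all $H\in D(H_0,\delta)$. (iii) In particular, $D(H_0,\delta)\subset B$ when $H_0$ is the zero matrix and $\delta_{j,k}=\frac1{2N}$ for $j\ne k$, $\delta_{j,j}=\frac1N$.
   Context: The 2D (complex) Hermite polynomials are, for nonnegative integers $m,n$ and $z_1,z_2\in\mathbb{C}$, $H_{m,n}(z_1,z_2)=\sum_{k=0}^{\min(m,n)}(-1)^k k!\binom mk\binom nk z_1^{m-k}z_2^{n-k}$. The sum $\sum_K$ runs over all $N\times N$ matrices $K=(k_{m,n})_{m,n=1}^N$ with nonnegative integer entries; $r_m=\sum_{\ell=1}^N k_{m,\ell}$ is the $m$-th row sum and $c_n=\sum_{j=1}^N k_{j,n}$ the $n$-th column sum of $K$. $I_N$ is the $N\times N$ identity matrix and $W^*$ is the conjugate transpose of $W$. The matrix $H$ is not assumed Hermitian. *)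

theory Defs
  imports "HOL-Analysis.Analysis"
begin

definition hermite2 :: "nat \<Rightarrow> nat \<Rightarrow> complex \<Rightarrow> complex \<Rightarrow> complex" where
  "hermite2 m n z1 z2 =
     (\<Sum>k=0..min m n. (-1) ^ k * fact k * of_nat (m choose k) * of_nat (n choose k)
        * z1 ^ (m - k) * z2 ^ (n - k))"

text \<open>The dimension \<open>N \<ge> 1\<close> is \<open>CARD('n)\<close>, and matrices are elements of \<open>complex ^ 'n ^ 'n\<close>,
  with \<open>H $ j $ l\<close> the entry in row \<open>j\<close> and column \<open>l\<close>.\<close>

definition row_sum :: "nat ^ 'n ^ 'n \<Rightarrow> 'n \<Rightarrow> nat" where
  "row_sum K m = (\<Sum>l\<in>UNIV. K $ m $ l)"

definition col_sum :: "nat ^ 'n ^ 'n \<Rightarrow> 'n \<Rightarrow> nat" where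
  "col_sum K n = (\<Sum>j\<in>UNIV. K $ j $ n)"

definition hermite_term :: "complex ^ 'n ^ 'n \<Rightarrow> complex ^ 'n \<Rightarrow> nat ^ 'n ^ 'n \<Rightarrow> complex" where
  "hermite_term H W K =
     (\<Prod>m\<in>UNIV. \<Prod>n\<in>UNIV. (H $ m $ n) ^ (K $ m $ n) / fact (K $ m $ n))
       * (\<Prod>j\<in>UNIV. hermite2 (row_sum K j) (col_sum K j) (cnj (W $ j)) (W $ j))"

definition max_norm :: "complex ^ 'n ^ 'n \<Rightarrow> real" where
  "max_norm H = Max (range (\<lambda>(j, l). cmod (H $ j $ l)))"

definition max_norm_ball :: "(complex ^ 'n ^ 'n) set" where
  "max_norm_ball = {H. max_norm H < 1 / real CARD('n)}"

definition hermitian_matrix :: "complex ^ 'n ^ 'n \<Rightarrow> bool" where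
  "hermitian_matrix H \<longleftrightarrow> (\<forall>j l. H $ j $ l = cnj (H $ l $ j))"

text \<open>The scalar \<open>W\<^sup>* M W\<close>.\<close>

definition sesq_form :: "complex ^ 'n ^ 'n \<Rightarrow> complex ^ 'n \<Rightarrow> complex" where
  "sesq_form M W = (\<Sum>j\<in>UNIV. cnj (W $ j) * (M *v W) $ j)"

definition u_part :: "complex ^ 'n ^ 'n \<Rightarrow> 'n \<Rightarrow> 'n \<Rightarrow> complex" where
  "u_part H l k = (H $ l $ k + H $ k $ l) / 2"

definition v_part :: "complex ^ 'n ^ 'n \<Rightarrow> 'n \<Rightarrow> 'n \<Rightarrow> complex" where
  "v_part H l k = (H $ l $ k - H $ k $ l) / (2 * \<i>)"

text \<open>The linear order on the index type serves only to express \<open>l < k\<close>; every \<open>N \<ge> 1\<close> is the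
  cardinality of a finite linearly ordered type.\<close>

definition hpolydisc ::
    "complex ^ 'n::{finite,linorder} ^ 'n::{finite,linorder} \<Rightarrow> real ^ 'n::{finite,linorder} ^ 'n::{finite,linorder}
       \<Rightarrow> (complex ^ 'n::{finite,linorder} ^ 'n::{finite,linorder}) set" where
  "hpolydisc H0 \<delta> = {H.
     (\<forall>j. cmod (H $ j $ j - H0 $ j $ j) < \<delta> $ j $ j) \<and>
     (\<forall>l k. l < k \<longrightarrow>
        cmod (u_part H l k - u_part H0 l k) < \<delta> $ l $ k \<and>
        cmod (v_part H l k - v_part H0 l k) < \<delta> $ l $ k)}"

end

theory Submission
  imports Defs
begin

text \<open>
The Hermite polynomial \<open>H\<^sub>m\<^sub>,\<^sub>n(x, y)\<close> is \<open>exp (- \<partial>\<^sub>x \<partial>\<^sub>y)\<close> applied to \<open>x ^ m * y ^ n\<close>. Without these operators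
the series over \<open>K\<close> is a product of exponential series and equals \<open>exp (a H b)\<close>, a Gaussian exponential
in the independent vectors \<open>a\<close> and \<open>b\<close>. Applying all the operators \<open>exp (T\<^sub>j \<partial>\<^sub>a\<^sub>j \<partial>\<^sub>b\<^sub>j)\<close> should turn it into
\<open>exp (a H (I - T H)\<inverse> b) / det (I - T H)\<close> with \<open>T\<close> the diagonal matrix of the \<open>T\<^sub>j\<close>; at \<open>T = -1\<close>,
\<open>a = cnj W\<close> and \<open>b = W\<close> this is the claimed identity.

The operators are applied one index at a time (\<open>heat_term_has_sum_exists\<close>). For one index only two scalar
variables move, and the series is \<open>C exp (\<alpha> x y + \<beta> x + \<gamma> y)\<close> in them; its diagonal Taylor coefficients
are explicit, and a negative binomial series sums them to a new Gaussian exponential with the extra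
factor \<open>1 / (1 - t \<alpha>)\<close> (\<open>heat_sum_has_sum\<close>). Here \<open>\<alpha>\<close> is a diagonal entry of \<open>H (I - T H)\<inverse>\<close>, and it has
modulus below 1 by a maximum principle, which is where \<open>N max |h| < 1\<close> enters
(\<open>resolvent_entry_bound\<close>). The factor and the new exponent are the matrix determinant lemma and the
Sherman-Morrison formula for a rank-one change of \<open>I - T H\<close>.

The interchange of summations in each step needs absolute convergence. For nonnegative data it is free
by Tonelli's theorem (\<open>heat_sum_summable\<close>), and the series with all entries equal to \<open>x\<close> and all signs
positive dominates every series with \<open>|h| \<le> x\<close>. The same nonnegative series is the majorant that gives
absolute and uniform convergence on compact sets. The identity holds at every matrix of the ball, hence
on every polydisc inside it.
\<close>

section \<open>Power series of Gaussian exponentials\<close>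

lemma negative_binomial_sums:
  fixes z :: "'a::{real_normed_field,banach}"
  assumes z: "norm z < 1"
  shows "summable (\<lambda>p. norm (of_nat (p + q choose p) * z ^ p)) \<and>
    (\<lambda>p. of_nat (p + q choose p) * z ^ p) sums (1 / (1 - z) ^ Suc q)"
proof (induction q)
  case 0
  show ?case using z geometric_sums[OF z] by (simp add: norm_power)
next
  case (Suc q)
  have geo: "summable (\<lambda>n. norm (z ^ n))" "(\<lambda>n. z ^ n) sums (1 / (1 - z))"
    using z geometric_sums[OF z] by (simp_all add: norm_power)
  have conv: "(\<Sum>i\<le>p. of_nat (i + q choose i) * w ^ i * w ^ (p - i)) = of_nat (p + Suc q choose p) * w ^ p"
    for p and w :: "'b::comm_semiring_1"
  proof -
    have "(\<Sum>i\<le>p. of_nat (i + q choose i) * w ^ i * w ^ (p - i)) = (\<Sum>i\<le>p. of_nat (q + i choose i)) * w ^ p"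
      by (auto simp: sum_distrib_right mult.assoc add.commute simp flip: power_add intro!: sum.cong)
    also have "(\<Sum>i\<le>p. of_nat (q + i choose i)) = (of_nat (p + Suc q choose p) :: 'b)"
      using sum_choose_lower[of q p] by (simp add: add.commute flip: of_nat_sum)
    finally show ?thesis .
  qed
  from Cauchy_product_sums[OF conjunct1[OF Suc] geo(1)] 
  have "(\<lambda>p. of_nat (p + Suc q choose p) * z ^ p) sums (1 / (1 - z) ^ Suc (Suc q))"
    unfolding conv by (simp only: conv power_Suc times_divide_times_eq flip: sums_unique[OF conjunct2[OF Suc]] sums_unique[OF geo(2)]) (simp add: mult_ac)
  moreover have "summable (\<lambda>p. \<Sum>i\<le>p. of_nat (i + q choose i) * norm z ^ i * norm z ^ (p - i))"
    by (rule summable_Cauchy_product) (use Suc z in \<open>auto simp: norm_mult norm_power\<close>)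
  ultimately show ?case by (simp add: norm_mult norm_power conv)
qed

lemma negative_binomial_has_sum:
  fixes z :: "'a::{real_normed_field,banach}"
  assumes "norm z < 1"
  shows "((\<lambda>p. of_nat (p + q choose p) * z ^ p) has_sum (1 / (1 - z) ^ Suc q)) UNIV"
  using negative_binomial_sums[OF assms, of q] by (auto intro: norm_summable_imp_has_sum)

lemma exp_has_sum:
  fixes z :: "'a::{real_normed_field,banach}"
  shows "((\<lambda>n. z ^ n / fact n) has_sum exp z) UNIV"
proof (rule norm_summable_imp_has_sum)
  have "summable (\<lambda>n. norm z ^ n / fact n)"
    using exp_converges[of "norm z"] by (auto simp: sums_iff field_simps)
  thus "summable (\<lambda>n. norm (z ^ n / fact n))"
    by (simp add: norm_divide norm_power)
  show "(\<lambda>n. z ^ n / fact n) sums exp z"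
    using exp_converges[of z] by (simp add: scaleR_conv_of_real field_simps)
qed

text \<open>The sum of \<open>l!\<close> times the coefficients of \<open>u ^ l v ^ l\<close> in \<open>exp (\<alpha> u v + \<beta> u + \<gamma> v)\<close>, where
\<open>d = \<beta> \<gamma>\<close>. The weight \<open>l!\<close> turns the exponential series in \<open>\<alpha>\<close> into negative binomial series of
radius 1; this is the source of the condition \<open>norm \<alpha> < 1\<close>.\<close>

lemma diagonal_series:
  fixes \<alpha> d :: complex
  assumes a: "norm \<alpha> < 1"
  shows "((\<lambda>l. fact l * (\<Sum>p\<le>l. \<alpha> ^ p * d ^ (l - p) / (fact p * (fact (l - p))\<^sup>2)))
           has_sum (exp (d / (1 - \<alpha>)) / (1 - \<alpha>))) UNIV"
proof -
  define f :: "nat \<times> nat \<Rightarrow> complex" 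
    where "f = (\<lambda>(q, p). d ^ q / fact q * (of_nat (p + q choose p) * \<alpha> ^ p))"
  have inner: "((\<lambda>p. y ^ q / fact q * (of_nat (p + q choose p) * x ^ p)) has_sum 
          ((y / (1 - x)) ^ q / fact q * (1 / (1 - x)))) UNIV"
    if "norm x < 1" for x y :: "'a::{real_normed_field,banach}" and q
    using has_sum_cmult_right[OF negative_binomial_has_sum[OF that, of q], of "y ^ q / fact q"]
    by (simp add: power_divide mult_ac)
  have outer: "((\<lambda>q. (y / (1 - x)) ^ q / fact q * (1 / (1 - x))) has_sum (exp (y / (1 - x)) * (1 / (1 - x)))) UNIV"
    for x y :: "'a::{real_normed_field,banach}"
    by (rule has_sum_cmult_left[OF exp_has_sum])
  \<comment> \<open>Sum over \<open>p\<close> by the negative binomial series, then over \<open>q\<close> by the exponential series; the triangle \<open>p \<le> l\<close> of the claim is the quadrant \<open>(q, p) = (l - p, p)\<close>.\<close>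
  have "(\<lambda>x. norm (f x)) summable_on UNIV \<times> UNIV"
  proof (rule summable_on_SigmaI)
    show "((\<lambda>p. norm (f (q, p))) has_sum ((norm d / (1 - norm \<alpha>)) ^ q / fact q * (1 / (1 - norm \<alpha>)))) UNIV" for q
      using inner[of "norm \<alpha>" "norm d" q] a by (simp add: f_def norm_mult norm_divide norm_power)
    show "(\<lambda>q. (norm d / (1 - norm \<alpha>)) ^ q / fact q * (1 / (1 - norm \<alpha>))) summable_on UNIV"
      by (rule has_sum_imp_summable[OF outer])
  qed auto
  hence summ: "f summable_on UNIV \<times> UNIV" by (rule abs_summable_summable)
  have "(f has_sum (exp (d / (1 - \<alpha>)) * (1 / (1 - \<alpha>)))) (UNIV \<times> UNIV)"
  proof (rule has_sum_SigmaI[OF _ _ summ])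
    show "((\<lambda>q. (d / (1 - \<alpha>)) ^ q / fact q * (1 / (1 - \<alpha>))) has_sum (exp (d / (1 - \<alpha>)) * (1 / (1 - \<alpha>)))) UNIV"
      by (rule outer)
    show "((\<lambda>p. f (q, p)) has_sum ((d / (1 - \<alpha>)) ^ q / fact q * (1 / (1 - \<alpha>)))) UNIV" for q
      unfolding f_def prod.case by (rule inner[OF a])
  qed
  also have "?this \<longleftrightarrow> ((\<lambda>(l, p). fact l * (\<alpha> ^ p * d ^ (l - p) / (fact p * (fact (l - p))\<^sup>2)))
       has_sum (exp (d / (1 - \<alpha>)) * (1 / (1 - \<alpha>)))) (SIGMA l:UNIV. {..l})"
  proof (rule has_sum_reindex_bij_witness[where j = "\<lambda>qp. (snd qp + fst qp, snd qp)" and i = "\<lambda>lp. (fst lp - snd lp, snd lp)"])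
    fix qp :: "nat \<times> nat"
    obtain q p where qp: "qp = (q, p)" by (cases qp)
    have "of_nat (p + q choose p) = (fact (p + q) / (fact p * fact q) :: complex)"
      by (simp add: binomial_fact)
    thus "(case (snd qp + fst qp, snd qp) of
        (l, p) \<Rightarrow> fact l * (\<alpha> ^ p * d ^ (l - p) / (fact p * (fact (l - p))\<^sup>2))) = f qp"
      by (simp add: qp f_def power2_eq_square mult_ac)
  next
    fix lp :: "nat \<times> nat" assume "lp \<in> (SIGMA l:UNIV. {..l})"
    thus "(snd (fst lp - snd lp, snd lp) + fst (fst lp - snd lp, snd lp), snd (fst lp - snd lp, snd lp)) = lp"
      by (cases lp) simp
  qed simp_all
  finally have "((\<lambda>l. \<Sum>p\<le>l. fact l * (\<alpha> ^ p * d ^ (l - p) / (fact p * (fact (l - p))\<^sup>2)))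
       has_sum (exp (d / (1 - \<alpha>)) * (1 / (1 - \<alpha>)))) UNIV"
  proof (rule has_sum_SigmaD)
    show "((\<lambda>p. case (l, p) of (l, p) \<Rightarrow> fact l * (\<alpha> ^ p * d ^ (l - p) / (fact p * (fact (l - p))\<^sup>2)))
       has_sum (\<Sum>p\<le>l. fact l * (\<alpha> ^ p * d ^ (l - p) / (fact p * (fact (l - p))\<^sup>2)))) {..l}" for l
      unfolding prod.case by (rule has_sum_finite) simp
  qed
  thus ?thesis by (simp only: sum_distrib_left times_divide_eq_right mult_1_right)
qed

lemma entire_power_series_unique:
  fixes a :: "nat \<Rightarrow> complex"
  assumes "\<And>z. ((\<lambda>n. a n * z ^ n) has_sum eval_fps F z) UNIV" and F: "fps_conv_radius F = \<infinity>"
  shows "a n = fps_nth F n"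
proof -
  have s: "(\<lambda>n. a n * z ^ n) sums eval_fps F z" for z
    using assms(1) by (rule has_sum_imp_sums)
  have "norm (1 :: complex) \<le> conv_radius a"
    by (rule conv_radius_geI) (use s[of 1] in \<open>auto simp: sums_iff\<close>)
  hence "0 < fps_conv_radius (Abs_fps a)"
    by (simp add: fps_conv_radius_def less_le_trans[of 0 "ereal 1"])
  moreover have "eval_fps (Abs_fps a) = eval_fps F"
    using s by (intro ext) (simp add: eval_fps_def[of "Abs_fps a"] sums_iff)
  ultimately have "Abs_fps a = F"
    using F by (intro eval_fps_eqD) auto
  thus ?thesis by auto
qed

text \<open>Only diagonal coefficients are needed below, since \<open>exp (t \<partial>\<^sub>x \<partial>\<^sub>y)\<close> differentiates equally often in both
variables. They are read off one variable at a time by uniqueness of power series.\<close>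

lemma diagonal_coefficient:
  fixes s :: "nat \<Rightarrow> nat \<Rightarrow> complex"
  assumes s: "\<And>u v. ((\<lambda>(k, l). s k l * u ^ k * v ^ l) has_sum (C * exp (\<alpha> * u * v + \<beta> * u + \<gamma> * v))) UNIV"
  shows "s l l = C * (\<Sum>p\<le>l. \<alpha> ^ p * (\<beta> * \<gamma>) ^ (l - p) / (fact p * (fact (l - p))\<^sup>2))"
proof -
  define P where "P = fps_const \<gamma> + fps_const \<alpha> * fps_X"
  have inf: "fps_conv_radius (F + G) = \<infinity>" "fps_conv_radius (F * G) = \<infinity>"
    if "fps_conv_radius F = \<infinity>" "fps_conv_radius G = \<infinity>" for F G :: "complex fps"
    using that fps_conv_radius_add[of F G] fps_conv_radius_mult[of F G] by auto
  have radP: "fps_conv_radius P = \<infinity>"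
    unfolding P_def by (intro inf) auto
  have evP: "eval_fps P u = \<gamma> + \<alpha> * u" for u
    unfolding P_def by (simp add: eval_fps_add eval_fps_mult inf)
  have radPl: "fps_conv_radius (P ^ l) = \<infinity>"
    using radP fps_conv_radius_power[of P l] by simp
  define Q where "Q = fps_const (C / fact l) * (fps_exp \<beta> * P ^ l)"
  have radQ: "fps_conv_radius Q = \<infinity>"
    unfolding Q_def by (intro inf radPl) auto
  have evQ: "eval_fps Q u = C / fact l * (exp (\<beta> * u) * (\<gamma> + \<alpha> * u) ^ l)" for u
    unfolding Q_def by (simp add: eval_fps_mult eval_fps_power inf radP radPl evP)
  \<comment> \<open>For fixed \<open>u\<close> the right-hand side is \<open>C exp (\<beta> u)\<close> times \<open>exp ((\<gamma> + \<alpha> u) v)\<close>; compare coefficients of \<open>v ^ l\<close>.\<close>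
  have row: "((\<lambda>k. s k l * u ^ k) has_sum eval_fps Q u) UNIV" for u
  proof -
    have "(\<lambda>(k, l). s k l * u ^ k * 1 ^ l) summable_on UNIV \<times> UNIV" 
      using s[of u 1] by (auto simp: has_sum_imp_summable)
    hence "(\<lambda>(l, k). s k l * u ^ k) summable_on UNIV \<times> UNIV"
      by (subst summable_on_swap) simp
    hence summ: "(\<lambda>k. s k l * u ^ k) summable_on UNIV" for l
      by (rule summable_on_SigmaD1) auto
    define F where "F = fps_const (C * exp (\<beta> * u)) * fps_exp (\<gamma> + \<alpha> * u)"
    have radF: "fps_conv_radius F = \<infinity>"
      unfolding F_def by (intro inf) auto
    have "((\<lambda>l. infsum (\<lambda>k. s k l * u ^ k) UNIV * v ^ l) has_sum eval_fps F v) UNIV" for v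
    proof (rule has_sum_SigmaD)
      have "eval_fps F v = C * exp (\<alpha> * u * v + \<beta> * u + \<gamma> * v)"
        unfolding F_def by (simp add: eval_fps_mult algebra_simps flip: exp_add)
      hence "((\<lambda>(k, l). s k l * u ^ k * v ^ l) has_sum eval_fps F v) (UNIV \<times> UNIV)"
        using s[of u v] by simp
      thus "((\<lambda>(l, k). s k l * u ^ k * v ^ l) has_sum eval_fps F v) (UNIV \<times> UNIV)"
        by (subst has_sum_swap) simp
      show "((\<lambda>k. (case (l, k) of (l, k) \<Rightarrow> s k l * u ^ k * v ^ l)) has_sum
            (infsum (\<lambda>k. s k l * u ^ k) UNIV * v ^ l)) UNIV" for l
        using has_sum_cmult_left[OF has_sum_infsum[OF summ[of l]], of "v ^ l"] by simp
    qed
    hence "infsum (\<lambda>k. s k l * u ^ k) UNIV = fps_nth F l"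
      using radF by (rule entire_power_series_unique)
    also have "\<dots> = eval_fps Q u"
      by (simp add: F_def evQ)
    finally show ?thesis using summ[of l] by (metis has_sum_infsum)
  qed
  have Pnth: "fps_nth (P ^ l) i = of_nat (l choose i) * \<alpha> ^ i * \<gamma> ^ (l - i)" for i
  proof -
    have "P ^ l = (\<Sum>j\<le>l. fps_const (of_nat (l choose j) * \<alpha> ^ j * \<gamma> ^ (l - j)) * fps_X ^ j)"
      unfolding P_def by (subst add.commute, subst binomial_ring)
        (simp add: power_mult_distrib fps_const_power mult_ac flip: fps_const_mult fps_of_nat)
    thus ?thesis
      by (auto simp: fps_sum_nth fps_X_power_nth if_distrib cong: if_cong)
  qed
  have "s l l = fps_nth Q l"
    using row radQ by (rule entire_power_series_unique)
  also have "\<dots> = C * (\<Sum>p\<le>l. \<alpha> ^ p * (\<beta> * \<gamma>) ^ (l - p) / (fact p * (fact (l - p))\<^sup>2))"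
  proof -
    have "fps_nth (P ^ l * fps_exp \<beta>) l = (\<Sum>p\<le>l. of_nat (l choose p) * \<alpha> ^ p * \<gamma> ^ (l - p) * (\<beta> ^ (l - p) / fact (l - p)))"
      by (simp add: fps_mult_nth Pnth atLeast0AtMost)
    also have "\<dots> = fact l * (\<Sum>p\<le>l. \<alpha> ^ p * (\<beta> * \<gamma>) ^ (l - p) / (fact p * (fact (l - p))\<^sup>2))"
      unfolding sum_distrib_left
      by (intro sum.cong refl) (simp add: binomial_fact power2_eq_square power_mult_distrib mult_ac)
    finally show ?thesis by (simp add: Q_def mult.commute[of "fps_exp \<beta>"])
  qed
  finally show ?thesis .
qed

section \<open>The heat operator in one pair of variables\<close>

text \<open>This is \<open>exp (t \<partial>\<^sub>x \<partial>\<^sub>y)\<close> applied to \<open>x ^ m * y ^ n\<close>. The Hermite polynomial is the value at \<open>t = -1\<close>, the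
plain monomial the value at \<open>t = 0\<close>, and \<open>t = 1\<close> gives the polynomial with all signs positive, which
dominates every case \<open>norm t \<le> 1\<close> when it is evaluated at the moduli of \<open>x\<close> and \<open>y\<close>.\<close>

definition heat_monomial :: "'a::real_normed_field \<Rightarrow> nat \<Rightarrow> nat \<Rightarrow> 'a \<Rightarrow> 'a \<Rightarrow> 'a" where
  "heat_monomial t m n x y =
     (\<Sum>k\<le>min m n. t ^ k * (fact k * of_nat (m choose k) * of_nat (n choose k) * x ^ (m - k) * y ^ (n - k)))"

text \<open>Binomial expansion as a sum over all of \<open>\<nat> \<times> \<nat>\<close>: the range does not depend on the exponents, so that
it can be interchanged with a sum in which the exponents vary.\<close>

lemma binomial_pair_has_sum:
  fixes x y u v :: "'a::real_normed_field"
  shows "((\<lambda>(k, l). of_nat (m choose k) * of_nat (n choose l) * x ^ (m - k) * y ^ (n - l) * u ^ k * v ^ l)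
           has_sum ((x + u) ^ m * (y + v) ^ n)) UNIV"
proof (rule has_sum_finite_neutralI[of "{..m} \<times> {..n}"])
  have "(u + x) ^ m * (v + y) ^ n = (\<Sum>(k, l)\<in>{..m} \<times> {..n}. 
     (of_nat (m choose k) * u ^ k * x ^ (m - k)) * (of_nat (n choose l) * v ^ l * y ^ (n - l)))"
    unfolding binomial_ring sum_product sum.cartesian_product ..
  thus "(x + u) ^ m * (y + v) ^ n = (\<Sum>(k, l)\<in>{..m} \<times> {..n}. 
     of_nat (m choose k) * of_nat (n choose l) * x ^ (m - k) * y ^ (n - l) * u ^ k * v ^ l)"
    by (simp add: add.commute mult_ac)
qed (auto simp: not_le binomial_eq_0)

text \<open>If a series of monomials in \<open>x\<close> and \<open>y\<close> sums to a Gaussian exponential everywhere, its Taylor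
coefficients about any point may be computed termwise: convergence at \<open>norm x + norm u\<close>,
\<open>norm y + norm v\<close> makes the expanded series absolutely convergent, and about the new centre the sum is
again a Gaussian exponential with the same \<open>\<alpha>\<close> and with \<open>\<alpha> y + \<beta>\<close> and \<open>\<alpha> x + \<gamma>\<close> in place of \<open>\<beta>\<close> and
\<open>\<gamma>\<close>.\<close>

lemma taylor_diagonal_has_sum:
  fixes p :: "'k \<Rightarrow> complex" and r c :: "'k \<Rightarrow> nat"
  assumes gauss: "\<And>x y. ((\<lambda>K. p K * (x ^ r K * y ^ c K)) has_sum (C * exp (\<alpha> * x * y + \<beta> * x + \<gamma> * y))) UNIV"
  shows "((\<lambda>K. p K * (of_nat (r K choose l) * of_nat (c K choose l) * x ^ (r K - l) * y ^ (c K - l)))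
     has_sum (C * exp (\<alpha> * x * y + \<beta> * x + \<gamma> * y) *
        (\<Sum>i\<le>l. \<alpha> ^ i * ((\<alpha> * y + \<beta>) * (\<alpha> * x + \<gamma>)) ^ (l - i) / (fact i * (fact (l - i))\<^sup>2)))) UNIV"
proof -
  define g where "g = (\<lambda>K k l. p K * (of_nat (r K choose k) * of_nat (c K choose l) * x ^ (r K - k) * y ^ (c K - l)))"
  have total: "((\<lambda>(kl, K). g K (fst kl) (snd kl) * (u ^ fst kl * v ^ snd kl))
        has_sum (C * exp (\<alpha> * (x + u) * (y + v) + \<beta> * (x + u) + \<gamma> * (y + v)))) (UNIV \<times> UNIV)" for u v
  proof -
    define F where "F = (\<lambda>(K, kl). g K (fst kl) (snd kl) * (u ^ fst kl * v ^ snd kl))"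
    have "(\<lambda>z. norm (F z)) summable_on UNIV \<times> UNIV"
    proof (rule summable_on_SigmaI)
      show "((\<lambda>kl. norm (F (K, kl))) has_sum 
          (norm (p K) * ((norm x + norm u) ^ r K * (norm y + norm v) ^ c K))) UNIV" for K
        using has_sum_cmult_right[OF binomial_pair_has_sum[of "r K" "c K" "norm x" "norm y" "norm u" "norm v"], of "norm (p K)"]
        by (simp add: F_def g_def norm_mult norm_power case_prod_beta mult.assoc)
      have "(\<lambda>K. norm (p K * (of_real (norm x + norm u) ^ r K * of_real (norm y + norm v) ^ c K))) summable_on UNIV"
        using has_sum_imp_summable[OF gauss] by (simp only: summable_on_iff_abs_summable_on_complex)
      moreover have "norm (complex_of_real (norm x + norm u)) = norm x + norm u"
        "norm (complex_of_real (norm y + norm v)) = norm y + norm v"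
        by (simp_all only: norm_of_real) auto
      ultimately show "(\<lambda>K. norm (p K) * ((norm x + norm u) ^ r K * (norm y + norm v) ^ c K)) summable_on UNIV"
        by (simp only: norm_mult norm_power)
    qed auto
    hence "F summable_on UNIV \<times> UNIV" by (rule abs_summable_summable)
    hence "(F has_sum (C * exp (\<alpha> * (x + u) * (y + v) + \<beta> * (x + u) + \<gamma> * (y + v)))) (UNIV \<times> UNIV)"
    proof (rule has_sum_SigmaI[rotated 2])
      show "((\<lambda>kl. F (K, kl)) has_sum (p K * ((x + u) ^ r K * (y + v) ^ c K))) UNIV" for K
        using has_sum_cmult_right[OF binomial_pair_has_sum[of "r K" "c K" x y u v], of "p K"]
        by (simp add: F_def g_def case_prod_beta mult.assoc)
    qed (rule gauss)
    thus ?thesis by (subst has_sum_swap) (simp add: F_def)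
  qed
  \<comment> \<open>At \<open>u = v = 1\<close> the powers of \<open>u\<close> and \<open>v\<close> disappear.\<close>
  have summ: "(\<lambda>K. g K k l) summable_on UNIV" for k l
  proof -
    have "(\<lambda>(kl, K). g K (fst kl) (snd kl)) summable_on UNIV \<times> UNIV"
      using has_sum_imp_summable[OF total[of 1 1]] by simp
    hence "(\<lambda>K. g K (fst (k, l)) (snd (k, l))) summable_on UNIV"
      by (rule summable_on_SigmaD1) simp
    thus ?thesis by simp
  qed
  have "((\<lambda>(k, l). infsum (\<lambda>K. g K k l) UNIV * u ^ k * v ^ l) has_sum
     (C * exp (\<alpha> * x * y + \<beta> * x + \<gamma> * y) * exp (\<alpha> * u * v + (\<alpha> * y + \<beta>) * u + (\<alpha> * x + \<gamma>) * v))) UNIV" for u v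
  proof (rule has_sum_SigmaD)
    have "C * exp (\<alpha> * (x + u) * (y + v) + \<beta> * (x + u) + \<gamma> * (y + v)) = 
      C * exp (\<alpha> * x * y + \<beta> * x + \<gamma> * y) * exp (\<alpha> * u * v + (\<alpha> * y + \<beta>) * u + (\<alpha> * x + \<gamma>) * v)"
      by (simp add: mult.assoc flip: exp_add) (simp add: algebra_simps)
    thus "((\<lambda>(kl, K). g K (fst kl) (snd kl) * (u ^ fst kl * v ^ snd kl)) has_sum
        (C * exp (\<alpha> * x * y + \<beta> * x + \<gamma> * y) * exp (\<alpha> * u * v + (\<alpha> * y + \<beta>) * u + (\<alpha> * x + \<gamma>) * v))) (UNIV \<times> UNIV)"
      using total[of u v] by (simp only:)
    show "((\<lambda>K. case (kl, K) of (kl, K) \<Rightarrow> g K (fst kl) (snd kl) * (u ^ fst kl * v ^ snd kl)) has_sum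
        (case kl of (k, l) \<Rightarrow> infsum (\<lambda>K. g K k l) UNIV * u ^ k * v ^ l)) UNIV" for kl
      using has_sum_cmult_left[OF has_sum_infsum[OF summ[of "fst kl" "snd kl"]], of "u ^ fst kl * v ^ snd kl"] 
      by (simp add: case_prod_beta mult.assoc)
  qed
  from diagonal_coefficient[OF this, of l] show ?thesis
    using has_sum_infsum[OF summ[of l l]] by (simp add: g_def)
qed

text \<open>With nonnegative coefficients at a nonnegative point nothing cancels, so convergence of the series of
diagonal Taylor coefficients, weighted by \<open>l!\<close>, already gives convergence of the double series, by
Tonelli's theorem.\<close>

lemma heat_sum_summable:
  fixes p :: "'k \<Rightarrow> real" and r c :: "'k \<Rightarrow> nat" and C \<alpha> \<beta> \<gamma> :: complex
  assumes gauss: "\<And>x y. ((\<lambda>K. of_real (p K) * (x ^ r K * y ^ c K)) has_sum (C * exp (\<alpha> * x * y + \<beta> * x + \<gamma> * y))) UNIV"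
    and nonneg: "\<And>K. p K \<ge> 0" "x \<ge> 0" "y \<ge> 0" and \<alpha>: "norm \<alpha> < 1"
  shows "(\<lambda>(K, l). p K * (fact l * of_nat (r K choose l) * of_nat (c K choose l) * x ^ (r K - l) * y ^ (c K - l)))
     summable_on (UNIV \<times> UNIV)"
proof -
  define S where "S = (\<lambda>l. C * exp (\<alpha> * x * y + \<beta> * x + \<gamma> * y) *
        (\<Sum>i\<le>l. \<alpha> ^ i * ((\<alpha> * y + \<beta>) * (\<alpha> * x + \<gamma>)) ^ (l - i) / (fact i * (fact (l - i))\<^sup>2)))"
  have "((\<lambda>K. Re (of_real (p K) * (of_nat (r K choose l) * of_nat (c K choose l) * of_real x ^ (r K - l) * of_real y ^ (c K - l))))
     has_sum (Re (S l))) UNIV" for l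
    unfolding S_def by (rule has_sum_Re, rule taylor_diagonal_has_sum) (rule gauss)
  moreover have "Re (of_real (p K) * (of_nat (r K choose l) * of_nat (c K choose l) * of_real x ^ (r K - l) * of_real y ^ (c K - l)))
      = p K * (of_nat (r K choose l) * of_nat (c K choose l) * x ^ (r K - l) * y ^ (c K - l))" for K l
  proof -
    have "complex_of_real (p K) * (of_nat (r K choose l) * of_nat (c K choose l) * of_real x ^ (r K - l) * of_real y ^ (c K - l))
      = of_real (p K * (of_nat (r K choose l) * of_nat (c K choose l) * x ^ (r K - l) * y ^ (c K - l)))"
      by simp
    thus ?thesis by (simp only: Re_complex_of_real)
  qed
  ultimately have "((\<lambda>K. p K * (of_nat (r K choose l) * of_nat (c K choose l) * x ^ (r K - l) * y ^ (c K - l)))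
     has_sum (Re (S l))) UNIV" for l
    by simp
  from has_sum_cmult_right[OF this, of "fact l" for l]
  have inner: "((\<lambda>K. p K * (fact l * of_nat (r K choose l) * of_nat (c K choose l) * x ^ (r K - l) * y ^ (c K - l)))
     has_sum (Re (fact l * S l))) UNIV" for l
    by (simp add: mult_ac)
  have "(\<lambda>l. fact l * S l) summable_on UNIV"
    using summable_on_cmult_right[OF has_sum_imp_summable[OF diagonal_series[OF \<alpha>, 
         of "(\<alpha> * y + \<beta>) * (\<alpha> * x + \<gamma>)"]], of "C * exp (\<alpha> * x * y + \<beta> * x + \<gamma> * y)"]
    unfolding S_def by (simp only: mult_ac)
  hence "(\<lambda>l. Re (fact l * S l)) summable_on UNIV"
    by (rule summable_on_Re)
  hence "(\<lambda>(l, K). p K * (fact l * of_nat (r K choose l) * of_nat (c K choose l) * x ^ (r K - l) * y ^ (c K - l)))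
     summable_on (UNIV \<times> UNIV)"
    by (rule summable_on_SigmaI[rotated]) (use inner nonneg in auto)
  thus ?thesis by (subst summable_on_swap) simp
qed

text \<open>The operator \<open>exp (t \<partial>\<^sub>x \<partial>\<^sub>y)\<close> acts termwise on such a series, and its effect on a Gaussian exponential is
again Gaussian: the value at \<open>(x, y)\<close> is \<open>\<Sum>l. t ^ l * l!\<close> times the diagonal Taylor coefficient.\<close>

lemma heat_sum_has_sum:
  fixes p :: "'k \<Rightarrow> complex" and r c :: "'k \<Rightarrow> nat"
  assumes gauss: "\<And>x y. ((\<lambda>K. p K * (x ^ r K * y ^ c K)) has_sum (C * exp (\<alpha> * x * y + \<beta> * x + \<gamma> * y))) UNIV"
    and summ: "(\<lambda>(K, l). norm (p K) * (fact l * of_nat (r K choose l) * of_nat (c K choose l) * norm x ^ (r K - l) * norm y ^ (c K - l)))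
     summable_on (UNIV \<times> UNIV)"
    and \<alpha>: "norm \<alpha> < 1" and t: "norm t \<le> 1"
  shows "((\<lambda>K. p K * heat_monomial t (r K) (c K) x y) has_sum
     (C / (1 - t * \<alpha>) * exp (\<alpha> * x * y + \<beta> * x + \<gamma> * y + t * ((\<alpha> * y + \<beta>) * (\<alpha> * x + \<gamma>)) / (1 - t * \<alpha>)))) UNIV"
proof -
  define d where "d = (\<alpha> * y + \<beta>) * (\<alpha> * x + \<gamma>)"
  define E where "E = C * exp (\<alpha> * x * y + \<beta> * x + \<gamma> * y)"
  define F where "F = (\<lambda>(K, l). p K * (t ^ l * (fact l * of_nat (r K choose l) * of_nat (c K choose l) * x ^ (r K - l) * y ^ (c K - l))))"
  have "(\<lambda>z. norm (F z)) summable_on (UNIV \<times> UNIV)"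
  proof (rule Infinite_Sum.abs_summable_on_comparison_test'[OF summ])
    fix z :: "'k \<times> nat"
    have "norm t ^ snd z \<le> 1" using t by (simp add: power_le_one)
    thus "norm (F z) \<le> (case z of (K, l) \<Rightarrow> norm (p K) * (fact l * of_nat (r K choose l) * of_nat (c K choose l) * norm x ^ (r K - l) * norm y ^ (c K - l)))"
      by (auto simp: F_def case_prod_beta norm_mult norm_power intro!: mult_left_mono mult_left_le_one_le)
  qed
  hence summF: "F summable_on (UNIV \<times> UNIV)" by (rule abs_summable_summable)
  have "(F has_sum (E * (exp (t * d / (1 - t * \<alpha>)) / (1 - t * \<alpha>)))) (UNIV \<times> UNIV)"
  proof (subst has_sum_swap, rule has_sum_SigmaI)
    have "norm (t * \<alpha>) < 1"
      using t \<alpha> by (simp add: norm_mult) (metis le_less_trans mult_left_le_one_le norm_ge_zero)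
    from has_sum_cmult_right[OF diagonal_series[OF this, of "t * d"], of E]
    show "((\<lambda>l. E * (fact l * (\<Sum>i\<le>l. (t * \<alpha>) ^ i * (t * d) ^ (l - i) / (fact i * (fact (l - i))\<^sup>2))))
      has_sum (E * (exp (t * d / (1 - t * \<alpha>)) / (1 - t * \<alpha>)))) UNIV" .
    show "((\<lambda>K. case (l, K) of (l, K) \<Rightarrow> F (K, l)) has_sum
         (E * (fact l * (\<Sum>i\<le>l. (t * \<alpha>) ^ i * (t * d) ^ (l - i) / (fact i * (fact (l - i))\<^sup>2))))) UNIV" for l
    proof -
      have "(t * \<alpha>) ^ i * (t * d) ^ (l - i) = t ^ l * (\<alpha> ^ i * d ^ (l - i))" if "i \<le> l" for i
        using that power_add[of t i "l - i"] by (simp add: power_mult_distrib mult_ac)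
      hence "(\<Sum>i\<le>l. (t * \<alpha>) ^ i * (t * d) ^ (l - i) / (fact i * (fact (l - i))\<^sup>2)) = 
         t ^ l * (\<Sum>i\<le>l. \<alpha> ^ i * d ^ (l - i) / (fact i * (fact (l - i))\<^sup>2))"
        unfolding sum_distrib_left by (intro sum.cong) auto
      thus ?thesis
        using has_sum_cmult_right[OF taylor_diagonal_has_sum[OF gauss, where l = l and x = x and y = y, folded d_def E_def], of "t ^ l * fact l"]
        by (simp add: F_def mult_ac)
    qed
    show "(\<lambda>(l, K). F (K, l)) summable_on UNIV \<times> UNIV"
      using summF by (subst (asm) summable_on_swap)
  qed
  hence "((\<lambda>K. p K * heat_monomial t (r K) (c K) x y) has_sum (E * (exp (t * d / (1 - t * \<alpha>)) / (1 - t * \<alpha>)))) UNIV"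
  proof (rule has_sum_SigmaD)
    show "((\<lambda>l. F (K, l)) has_sum (p K * heat_monomial t (r K) (c K) x y)) UNIV" for K
      by (rule has_sum_finite_neutralI[of "{..min (r K) (c K)}"])
         (auto simp: F_def heat_monomial_def sum_distrib_left not_le binomial_eq_0 min_def split: if_splits)
  qed
  thus ?thesis by (simp add: E_def d_def exp_add mult_ac)
qed

section \<open>The resolvent of a matrix under rank-one changes\<close>

text \<open>The matrix \<open>I - diag(T) H\<close>. Its resolvent \<open>H (I - diag(T) H)\<inverse>\<close> is described below as any \<open>G\<close> with
\<open>G ** heat_matrix T H = H\<close>, which avoids inverse matrices in the induction.\<close>

definition heat_matrix :: "('n \<Rightarrow> complex) \<Rightarrow> complex ^ 'n ^ 'n \<Rightarrow> complex ^ 'n ^ 'n" where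
  "heat_matrix T H = (\<chi> i k. (if i = k then 1 else 0) - T i * H $ i $ k)"

definition bilinear_form :: "complex ^ 'n ^ 'n \<Rightarrow> ('n::finite \<Rightarrow> complex) \<Rightarrow> ('n \<Rightarrow> complex) \<Rightarrow> complex" where
  "bilinear_form G a b = (\<Sum>i\<in>UNIV. \<Sum>k\<in>UNIV. a i * G $ i $ k * b k)"

text \<open>Changing \<open>T j\<close> from 0 to \<open>t\<close> multiplies \<open>heat_matrix T H\<close> on the left by a rank-one perturbation of the
identity, because row \<open>j\<close> of \<open>G\<close> times \<open>heat_matrix T H\<close> is row \<open>j\<close> of \<open>H\<close>.\<close>

lemma det_heat_matrix_update:
  fixes G H :: "complex ^ 'n::finite ^ 'n"
  assumes G: "G ** heat_matrix T H = H" and T: "T j = 0"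
  shows "det (heat_matrix (T(j := t)) H) = (1 - t * G $ j $ j) * det (heat_matrix T H)"
proof -
  define x :: "complex ^ 'n" where "x = (\<chi> k. (if k = j then 1 else 0) - t * G $ j $ k)"
  \<comment> \<open>The rank-one factor \<open>I - t e g\<close>, with \<open>e\<close> the \<open>j\<close>-th unit column and \<open>g\<close> the \<open>j\<close>-th row of \<open>G\<close>, written as the identity with row \<open>j\<close> replaced by \<open>x\<close> so that Cramer's lemma gives its determinant.\<close>
  define M :: "complex ^ 'n ^ 'n"
    where "M = (\<chi> i. if i = j then \<Sum>l\<in>UNIV. x $ l *s row l (mat 1) else row i (mat 1))"
  have "M $ i $ k = (if i = j then x $ k else mat 1 $ i $ k)" for i k
    by (cases "i = j") (simp_all add: M_def row_def mat_def if_distrib cong: if_cong)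
  hence M: "M $ i $ k = (if i = k then 1 else 0) - (if i = j then t * G $ j $ k else 0)" for i k
    by (auto simp: x_def mat_def)
  have "M ** heat_matrix T H = heat_matrix (T(j := t)) H"
  proof -
    have "(\<Sum>l\<in>UNIV. M $ i $ l * heat_matrix T H $ l $ k) = heat_matrix (T(j := t)) H $ i $ k" for i k
    proof -
      have "(\<Sum>l\<in>UNIV. M $ i $ l * heat_matrix T H $ l $ k) = heat_matrix T H $ i $ k
         - (if i = j then t * (\<Sum>l\<in>UNIV. G $ j $ l * heat_matrix T H $ l $ k) else 0)"
      proof -
        have "M $ i $ l * heat_matrix T H $ l $ k = (if l = i then heat_matrix T H $ l $ k else 0)
           - (if i = j then t * (G $ j $ l * heat_matrix T H $ l $ k) else 0)" for l
          by (simp add: M left_diff_distrib mult.assoc)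
        thus ?thesis by (simp add: sum_subtractf sum_distrib_left)
      qed
      also have "(\<Sum>l\<in>UNIV. G $ j $ l * heat_matrix T H $ l $ k) = H $ j $ k"
        using arg_cong[OF G, of "\<lambda>A. A $ j $ k"] by (simp add: matrix_matrix_mult_def)
      finally show ?thesis by (auto simp: heat_matrix_def T)
    qed
    thus ?thesis by (simp add: matrix_matrix_mult_def vec_eq_iff)
  qed
  moreover have "det M = x $ j * det (mat 1 :: complex ^ 'n ^ 'n)"
    unfolding M_def by (rule cramer_lemma_transpose)
  ultimately show ?thesis using det_mul[of M "heat_matrix T H"] by (simp add: x_def)
qed

text \<open>The Sherman-Morrison formula for the same rank-one change.\<close>

lemma resolvent_update:
  fixes G H :: "complex ^ 'n::finite ^ 'n"
  assumes G: "G ** heat_matrix T H = H" and T: "T j = 0" and nz: "1 - t * G $ j $ j \<noteq> 0"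
  shows "(\<chi> i k. G $ i $ k + t * G $ i $ j * G $ j $ k / (1 - t * G $ j $ j)) ** heat_matrix (T(j := t)) H = H"
proof -
  define G' :: "complex ^ 'n ^ 'n" where "G' = (\<chi> i k. G $ i $ k + t * G $ i $ j * G $ j $ k / (1 - t * G $ j $ j))"
  have "(\<Sum>l\<in>UNIV. G' $ i $ l * heat_matrix (T(j := t)) H $ l $ k) = H $ i $ k" for i k
  proof -
    have L: "heat_matrix (T(j := t)) H $ l $ k = heat_matrix T H $ l $ k - (if l = j then t * H $ j $ k else 0)" for l
      by (simp add: heat_matrix_def T)
    have Gl: "(\<Sum>l\<in>UNIV. G $ i $ l * heat_matrix T H $ l $ k) = H $ i $ k" for i
      using arg_cong[OF G, of "\<lambda>A. A $ i $ k"] by (simp add: matrix_matrix_mult_def)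
    have "g + t * g * \<alpha> / s = g * (s + t * \<alpha>) / s" if "s \<noteq> 0" for g \<alpha> s :: complex
      using that by (simp add: field_simps)
    from this[OF nz, of "G $ i $ j" "G $ j $ j"]
    have G'_eq: "G' $ i $ j = G $ i $ j / (1 - t * G $ j $ j)" by (simp add: G'_def)
    have "(\<Sum>l\<in>UNIV. G' $ i $ l * heat_matrix (T(j := t)) H $ l $ k) =
       (\<Sum>l\<in>UNIV. G' $ i $ l * heat_matrix T H $ l $ k) - (\<Sum>l\<in>UNIV. G' $ i $ l * (if l = j then t * H $ j $ k else 0))"
      by (simp only: L right_diff_distrib sum_subtractf)
    also have "(\<Sum>l\<in>UNIV. G' $ i $ l * (if l = j then t * H $ j $ k else 0)) = G' $ i $ j * (t * H $ j $ k)"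
      by (simp add: if_distrib cong: if_cong)
    also have "(\<Sum>l\<in>UNIV. G' $ i $ l * heat_matrix T H $ l $ k) = (\<Sum>l\<in>UNIV. G $ i $ l * heat_matrix T H $ l $ k)
       + t * G $ i $ j / (1 - t * G $ j $ j) * (\<Sum>l\<in>UNIV. G $ j $ l * heat_matrix T H $ l $ k)"
    proof -
      have "G' $ i $ l * heat_matrix T H $ l $ k = G $ i $ l * heat_matrix T H $ l $ k
        + t * G $ i $ j / (1 - t * G $ j $ j) * (G $ j $ l * heat_matrix T H $ l $ k)" for l
        by (simp add: G'_def distrib_right mult.assoc)
      thus ?thesis by (simp only: sum.distrib sum_distrib_left)
    qed
    finally show ?thesis unfolding Gl G'_eq by (simp del: fun_upd_apply)
  qed
  thus ?thesis unfolding G'_def[symmetric] by (simp add: matrix_matrix_mult_def vec_eq_iff)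
qed

text \<open>A maximum principle: it supplies the condition \<open>norm \<alpha> < 1\<close> of the one-variable step, whose \<open>\<alpha>\<close> is a
diagonal entry of the resolvent.\<close>

lemma resolvent_entry_bound:
  fixes G H :: "complex ^ 'n::finite ^ 'n"
  assumes G: "G ** heat_matrix T H = H" and inv: "det (heat_matrix T H) \<noteq> 0" 
    and T: "T j = 0" "\<And>i. norm (T i) \<le> 1"
    and H: "\<And>i k. norm (H $ i $ k) \<le> x" and x: "real CARD('n) * x < 1"
  shows "norm (G $ j $ j) < 1"
proof -
  obtain B where B: "heat_matrix T H ** B = mat 1"
    using inv by (auto simp: invertible_det_nz[symmetric] invertible_def)
  \<comment> \<open>The entry is \<open>(H y) $ j\<close> for the solution \<open>y\<close> of \<open>(I - T H) y = e\<close>, so a bound on the largest entry of \<open>y\<close> suffices.\<close>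
  define y where "y = B *v axis j 1"
  have Ly: "heat_matrix T H *v y = axis j 1"
    by (simp add: y_def matrix_vector_mul_assoc B)
  have Gjj: "G $ j $ j = (H *v y) $ j"
  proof -
    have "H *v y = G *v (heat_matrix T H *v y)"
      by (simp add: matrix_vector_mul_assoc G)
    moreover have "(G *v axis j 1) $ j = G $ j $ j"
      by (simp add: matrix_vector_mult_def axis_def if_distrib cong: if_cong)
    ultimately show ?thesis by (simp only: Ly)
  qed
  have y: "y $ i = (if i = j then 1 else 0) + T i * (H *v y) $ i" for i
  proof -
    have "(heat_matrix T H *v y) $ i = y $ i - T i * (H *v y) $ i"
    proof -
      have "heat_matrix T H $ i $ k * y $ k = (if k = i then y $ k else 0) - T i * (H $ i $ k * y $ k)" for k
        by (simp add: heat_matrix_def left_diff_distrib mult.assoc)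
      thus ?thesis by (simp add: matrix_vector_mult_def sum_subtractf sum_distrib_left)
    qed
    thus ?thesis by (simp add: Ly axis_def)
  qed
  define Y where "Y = Max (range (\<lambda>i. norm (y $ i)))"
  have yY: "norm (y $ i) \<le> Y" for i
    unfolding Y_def by (intro Max_ge) auto
  have "Y \<in> range (\<lambda>i. norm (y $ i))"
    unfolding Y_def by (intro Max_in) auto
  then obtain m where m: "Y = norm (y $ m)" by auto
  have Y0: "Y \<ge> 0" by (simp add: m)
  have Hy: "norm ((H *v y) $ i) \<le> real CARD('n) * x * Y" for i
  proof -
    have "norm ((H *v y) $ i) \<le> (\<Sum>k\<in>UNIV. norm (H $ i $ k) * norm (y $ k))"
      unfolding matrix_vector_mult_def by (auto intro!: order_trans[OF norm_sum] simp: norm_mult)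
    also have "\<dots> \<le> (\<Sum>k\<in>(UNIV :: 'n set). x * Y)"
      by (intro sum_mono mult_mono H yY) (auto intro: order_trans[OF norm_ge_zero H])
    finally show ?thesis by simp
  qed
  \<comment> \<open>Away from \<open>j\<close>, each entry of \<open>y\<close> equals \<open>T i * (H y) $ i\<close> and is strictly smaller than the maximum unless \<open>y = 0\<close>, so a maximum above 1 is impossible.\<close>
  have Y1: "Y \<le> 1"
  proof (cases "m = j")
    case True
    thus ?thesis using y[of j] T by (simp add: m)
  next
    case False
    hence "Y = norm (T m) * norm ((H *v y) $ m)" using y[of m] by (simp add: m norm_mult)
    also have "\<dots> \<le> norm ((H *v y) $ m)" using T by (intro mult_left_le_one_le) auto
    also note Hy[of m]
    finally have "Y \<le> real CARD('n) * x * Y" .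
    hence "(1 - real CARD('n) * x) * Y \<le> 0" by (simp add: algebra_simps)
    hence "Y \<le> 0" using x by (simp add: mult_le_0_iff)
    thus ?thesis by simp
  qed
  have x0: "x \<ge> 0" using H[of j j] norm_ge_zero order_trans by blast
  have "norm (G $ j $ j) \<le> real CARD('n) * x * Y" unfolding Gjj by (rule Hy)
  also have "\<dots> \<le> real CARD('n) * x * 1" using Y1 x0 by (intro mult_left_mono) auto
  finally show ?thesis using x by simp
qed

text \<open>As a function of the single pair \<open>(a j, b j)\<close> the bilinear form has the exponent
\<open>\<alpha> x y + \<beta> x + \<gamma> y\<close> of the one-variable step.\<close>

lemma bilinear_form_update:
  fixes G :: "complex ^ 'n::finite ^ 'n" and j :: 'n
  defines "\<beta> \<equiv> \<lambda>b. (\<Sum>k\<in>UNIV - {j}. G $ j $ k * b k)" and "\<gamma> \<equiv> \<lambda>a. (\<Sum>i\<in>UNIV - {j}. a i * G $ i $ j)"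
  shows "bilinear_form G (a(j := x)) (b(j := y)) =
    G $ j $ j * x * y + \<beta> b * x + \<gamma> a * y + (\<Sum>i\<in>UNIV - {j}. \<Sum>k\<in>UNIV - {j}. a i * G $ i $ k * b k)"
proof -
  have r: "(\<Sum>i\<in>UNIV. f i) = f j + (\<Sum>i\<in>UNIV - {j}. f i)" for f :: "'n \<Rightarrow> complex"
    by (simp add: sum.remove)
  have "bilinear_form G (a(j := x)) (b(j := y)) = (\<Sum>k\<in>UNIV. x * G $ j $ k * (b(j := y)) k)
     + (\<Sum>i\<in>UNIV - {j}. \<Sum>k\<in>UNIV. a i * G $ i $ k * (b(j := y)) k)"
    unfolding bilinear_form_def by (subst r) simp
  also have "\<dots> = (x * G $ j $ j * y + (\<Sum>k\<in>UNIV - {j}. x * G $ j $ k * b k))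
     + (\<Sum>i\<in>UNIV - {j}. a i * G $ i $ j * y + (\<Sum>k\<in>UNIV - {j}. a i * G $ i $ k * b k))"
    by (simp add: r)
  finally show ?thesis
    by (simp add: \<beta>_def \<gamma>_def sum.distrib sum_distrib_left sum_distrib_right mult_ac)
qed

lemma bilinear_form_resolvent_update:
  fixes G :: "complex ^ 'n::finite ^ 'n"
  shows "bilinear_form (\<chi> i k. G $ i $ k + t * G $ i $ j * G $ j $ k / s) a b =
    bilinear_form G a b + t * ((\<Sum>k\<in>UNIV. G $ j $ k * b k) * (\<Sum>i\<in>UNIV. a i * G $ i $ j)) / s"
proof -
  have "a i * (G $ i $ k + t * G $ i $ j * G $ j $ k / s) * b k =
    a i * G $ i $ k * b k + t / s * ((a i * G $ i $ j) * (G $ j $ k * b k))" for i k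
    by (simp add: field_simps)
  hence "bilinear_form (\<chi> i k. G $ i $ k + t * G $ i $ j * G $ j $ k / s) a b = 
    bilinear_form G a b + t / s * ((\<Sum>i\<in>UNIV. a i * G $ i $ j) * (\<Sum>k\<in>UNIV. G $ j $ k * b k))"
    unfolding bilinear_form_def sum_product unfolding sum_distrib_left
    by (simp only: vec_lambda_beta sum.distrib)
  thus ?thesis by (simp add: mult_ac)
qed

section \<open>Series over nonnegative integer matrices\<close>

text \<open>The index set \<open>S\<close> allows one variable to be left out, so that the term can be seen as a monomial in that
variable. The definition is polymorphic in the scalars because real instances serve as majorants for
complex ones.\<close>

definition heat_term where
  "heat_term S T H a b K = 
     (\<Prod>m\<in>UNIV. \<Prod>n\<in>UNIV. (H $ m $ n) ^ (K $ m $ n) / fact (K $ m $ n))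
       * (\<Prod>j\<in>S. heat_monomial (T j) (row_sum K j) (col_sum K j) (a j) (b j))"

lemma heat_monomial_0: "heat_monomial 0 m n x y = x ^ m * y ^ n"
  by (simp add: heat_monomial_def power_0_left if_distrib if_distribR cong: if_cong)

lemma heat_monomial_of_real: 
  "heat_monomial (of_real t) m n (of_real x) (of_real y) = of_real (heat_monomial t m n x y)"
  by (simp add: heat_monomial_def)

lemma norm_heat_monomial_le:
  assumes "norm t \<le> t'" "norm x \<le> x'" "norm y \<le> y'"
  shows "norm (heat_monomial t m n x y) \<le> heat_monomial t' m n x' y'"
  unfolding heat_monomial_def
  by (rule order_trans[OF norm_sum], rule sum_mono)
     (auto simp: norm_mult norm_power intro!: mult_mono power_mono assms mult_nonneg_nonneg zero_le_power
         order_trans[OF norm_ge_zero assms(1)] order_trans[OF norm_ge_zero assms(2)] order_trans[OF norm_ge_zero assms(3)])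

lemma heat_term_of_real:
  "heat_term S (\<lambda>j. of_real (T j)) (\<chi> i k. of_real (H $ i $ k)) (\<lambda>j. of_real (a j)) (\<lambda>j. of_real (b j)) K 
     = (of_real (heat_term S T H a b K) :: complex)"
  by (simp add: heat_term_def heat_monomial_of_real)

lemma norm_heat_term_le:
  fixes H :: "complex ^ 'n::finite ^ 'n"
  assumes "\<And>j. norm (T j) \<le> T' j" "\<And>j. norm (a j) \<le> a' j" "\<And>j. norm (b j) \<le> b' j" "\<And>i k. norm (H $ i $ k) \<le> H' $ i $ k"
  shows "norm (heat_term S T H a b K) \<le> heat_term S T' H' a' b' K"
  unfolding heat_term_def norm_mult prod_norm[symmetric] norm_divide norm_power norm_fact
  by (intro mult_mono prod_mono conjI divide_right_mono power_mono assms norm_heat_monomial_le prod_nonneg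
        divide_nonneg_nonneg zero_le_power order_trans[OF norm_ge_zero assms(4)]) auto

lemma heat_term_nonneg:
  fixes H :: "real ^ 'n::finite ^ 'n"
  assumes "\<And>j. T j \<ge> 0" "\<And>j. a j \<ge> 0" "\<And>j. b j \<ge> 0" "\<And>i k. H $ i $ k \<ge> 0"
  shows "heat_term S T H a b K \<ge> 0"
  unfolding heat_term_def heat_monomial_def
  by (intro mult_nonneg_nonneg prod_nonneg sum_nonneg divide_nonneg_nonneg zero_le_power assms ballI) auto

lemma heat_term_split:
  fixes j :: "'n::finite"
  shows "heat_term UNIV T H a b K = heat_term (UNIV - {j}) T H a b K * 
    heat_monomial (T j) (row_sum K j) (col_sum K j) (a j) (b j)"
  unfolding heat_term_def by (subst prod.remove[of UNIV j]) (simp_all add: mult_ac)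

lemma heat_term_cong:
  assumes "\<And>i. i \<in> S \<Longrightarrow> T i = T' i" "\<And>i. i \<in> S \<Longrightarrow> a i = a' i" "\<And>i. i \<in> S \<Longrightarrow> b i = b' i"
  shows "heat_term S T H a b K = heat_term S T' H a' b' K"
  unfolding heat_term_def using assms by (auto intro!: prod.cong arg_cong2[of _ _ _ _ "(*)"])

lemma has_sum_product:
  fixes f :: "'a \<Rightarrow> complex" and g :: "'b \<Rightarrow> complex"
  assumes f: "(f has_sum x) A" and g: "(g has_sum y) B"
  shows "((\<lambda>(a, b). f a * g b) has_sum (x * y)) (A \<times> B)"
proof (rule has_sum_SigmaI)
  show "((\<lambda>b. case (a, b) of (a, b) \<Rightarrow> f a * g b) has_sum (f a * y)) B" for a
    using has_sum_cmult_right[OF g] by simp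
  show "((\<lambda>a. f a * y) has_sum (x * y)) A"
    by (rule has_sum_cmult_left[OF f])
  have af: "(\<lambda>a. norm (f a)) summable_on A" and ag: "(\<lambda>b. norm (g b)) summable_on B"
    using has_sum_imp_summable[OF f] has_sum_imp_summable[OF g] by (simp_all only: summable_on_iff_abs_summable_on_complex)
  have "(\<lambda>z. norm (case z of (a, b) \<Rightarrow> f a * g b)) summable_on A \<times> B"
  proof (rule summable_on_SigmaI)
    show "((\<lambda>b. norm (case (a, b) of (a, b) \<Rightarrow> f a * g b)) has_sum (norm (f a) * infsum (\<lambda>b. norm (g b)) B)) B" for a
      using has_sum_cmult_right[OF has_sum_infsum[OF ag], of "norm (f a)"] by (simp add: norm_mult)
    show "(\<lambda>a. norm (f a) * infsum (\<lambda>b. norm (g b)) B) summable_on A"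
      by (rule summable_on_cmult_left[OF af])
  qed auto
  thus "(\<lambda>(a, b). f a * g b) summable_on A \<times> B" by (rule abs_summable_summable)
qed

lemma has_sum_prod_PiE:
  fixes f :: "'a \<Rightarrow> 'b \<Rightarrow> complex"
  assumes "finite A" and "\<And>x. x \<in> A \<Longrightarrow> (f x has_sum s x) (B x)"
  shows "((\<lambda>g. \<Prod>x\<in>A. f x (g x)) has_sum (\<Prod>x\<in>A. s x)) (PiE A B)"
  using assms
proof (induction A)
  case empty
  show ?case by (simp add: has_sum_finiteI)
next
  case (insert x A)
  have "((\<lambda>(y, g). f x y * (\<Prod>x\<in>A. f x (g x))) has_sum (s x * (\<Prod>x\<in>A. s x))) (B x \<times> PiE A B)"
    using insert by (intro has_sum_product) auto
  also have "?this \<longleftrightarrow> (((\<lambda>g. \<Prod>x\<in>insert x A. f x (g x)) \<circ> (\<lambda>(y, g). g(x := y))) has_sum (s x * (\<Prod>x\<in>A. s x))) (B x \<times> PiE A B)"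
  proof (rule has_sum_cong)
    fix z assume "z \<in> B x \<times> PiE A B"
    obtain y g where z: "z = (y, g)" by (cases z)
    have "(\<Prod>x'\<in>A. f x' ((g(x := y)) x')) = (\<Prod>x'\<in>A. f x' (g x'))"
      using insert.hyps by (intro prod.cong) auto
    thus "(case z of (y, g) \<Rightarrow> f x y * (\<Prod>x\<in>A. f x (g x))) = ((\<lambda>g. \<Prod>x\<in>insert x A. f x (g x)) \<circ> (\<lambda>(y, g). g(x := y))) z"
      using insert.hyps by (simp add: z)
  qed
  also have "\<dots> \<longleftrightarrow> ((\<lambda>g. \<Prod>x\<in>insert x A. f x (g x)) has_sum (s x * (\<Prod>x\<in>A. s x))) (PiE (insert x A) B)"
    unfolding PiE_insert_eq using insert.hyps by (subst has_sum_reindex) (auto intro: inj_combinator)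
  finally show ?case using insert.hyps by simp
qed

text \<open>For \<open>T = 0\<close> every factor \<open>a m ^ r_m\<close>, \<open>b n ^ c_n\<close> distributes over the entries of \<open>K\<close>, and the series is a
product of \<open>N\<^sup>2\<close> exponential series.\<close>

lemma heat_term_has_sum_0:
  fixes H :: "complex ^ 'n::finite ^ 'n"
  shows "(heat_term UNIV (\<lambda>_. 0) H a b has_sum exp (bilinear_form H a b)) UNIV"
proof -
  define f where "f = (\<lambda>(m, n) k. (a m * H $ m $ n * b n) ^ k / fact k)"
  have "((\<lambda>g. \<Prod>x\<in>UNIV. f x (g x)) has_sum (\<Prod>(m, n)\<in>UNIV. exp (a m * H $ m $ n * b n))) (PiE UNIV (\<lambda>_. UNIV))"
    by (intro has_sum_prod_PiE) (auto simp: f_def intro!: exp_has_sum)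
  also have "(\<Prod>(m, n)\<in>UNIV. exp (a m * H $ m $ n * b n)) = exp (bilinear_form H a b)"
    unfolding bilinear_form_def sum.cartesian_product by (simp add: exp_sum case_prod_beta)
  also have "((\<lambda>g. \<Prod>x\<in>UNIV. f x (g x)) has_sum exp (bilinear_form H a b)) (PiE UNIV (\<lambda>_. UNIV)) \<longleftrightarrow> ?thesis"
  proof (rule has_sum_reindex_bij_witness[where j = "\<lambda>g. \<chi> m n. g (m, n)" and i = "\<lambda>K mn. K $ fst mn $ snd mn"])
    fix g :: "'n \<times> 'n \<Rightarrow> nat"
    have "(\<Prod>m\<in>UNIV. \<Prod>n\<in>UNIV. a m ^ g (m, n)) = (\<Prod>m\<in>UNIV. a m ^ (\<Sum>n\<in>UNIV. g (m, n)))"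
      by (simp add: power_sum)
    moreover have "(\<Prod>m\<in>UNIV. \<Prod>n\<in>UNIV. b n ^ g (m, n)) = (\<Prod>n\<in>UNIV. b n ^ (\<Sum>m\<in>UNIV. g (m, n)))"
      by (subst prod.swap) (simp add: power_sum)
    moreover have "(\<Prod>x\<in>UNIV. f x (g x)) = (\<Prod>m\<in>UNIV. \<Prod>n\<in>UNIV. f (m, n) (g (m, n)))"
      by (simp add: prod.cartesian_product)
    ultimately show "heat_term UNIV (\<lambda>_. 0) H a b (\<chi> m n. g (m, n)) = (\<Prod>x\<in>UNIV. f x (g x))"
      by (simp add: heat_term_def heat_monomial_0 f_def row_sum_def col_sum_def power_mult_distrib prod.distrib prod_dividef)
  qed auto
  finally show ?thesis .
qed

section \<open>The generating function of products of Hermite polynomials\<close>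

lemma heat_term_slice:
  fixes H G :: "complex ^ 'n::finite ^ 'n"
  assumes sum: "\<And>a b. (heat_term UNIV T H a b has_sum (exp (bilinear_form G a b) / D)) UNIV" and T: "T j = 0"
  shows "((\<lambda>K. heat_term (UNIV - {j}) T H a b K * (x ^ row_sum K j * y ^ col_sum K j)) has_sum
    (exp (\<Sum>i\<in>UNIV - {j}. \<Sum>k\<in>UNIV - {j}. a i * G $ i $ k * b k) / D *
     exp (G $ j $ j * x * y + (\<Sum>k\<in>UNIV - {j}. G $ j $ k * b k) * x + (\<Sum>i\<in>UNIV - {j}. a i * G $ i $ j) * y))) UNIV"
proof -
  have "heat_term UNIV T H (a(j := x)) (b(j := y)) = 
      (\<lambda>K. heat_term (UNIV - {j}) T H a b K * (x ^ row_sum K j * y ^ col_sum K j))"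
  proof
    fix K
    show "heat_term UNIV T H (a(j := x)) (b(j := y)) K = 
      heat_term (UNIV - {j}) T H a b K * (x ^ row_sum K j * y ^ col_sum K j)"
    unfolding heat_term_split[of T H _ _ K j] T heat_monomial_0
    by (subst heat_term_cong[of "UNIV - {j}" T T "a(j := x)" a "b(j := y)" b]) simp_all
  qed
  with sum[of "a(j := x)" "b(j := y)"] show ?thesis
    by (simp add: bilinear_form_update exp_add mult_ac)
qed

text \<open>The heat operators \<open>exp (T j \<partial>\<^sub>a \<partial>\<^sub>b)\<close>, acting on \<open>(a j, b j)\<close>, are switched on one index at a time. In the
step for \<open>j\<close> the series with \<open>T j = 0\<close> is a Gaussian exponential in \<open>(a j, b j)\<close>, and the one-variable
result multiplies the sum by \<open>1 / (1 - t G\<^sub>j\<^sub>j)\<close> and changes the exponent in exactly the way in which the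
determinant and the resolvent change. The induction hypothesis is used twice: for the value at the
given data, and at constant matrices with \<open>T = 1\<close> on \<open>A\<close>, where it provides the absolute convergence that
the step requires.\<close>

lemma heat_term_has_sum_exists:
  fixes H :: "complex ^ 'n::finite ^ 'n" and A :: "'n set"
  assumes x: "real CARD('n) * x < 1"
    and "\<And>j. j \<notin> A \<Longrightarrow> T j = 0" "\<And>j. norm (T j) \<le> 1" "\<And>i k. norm (H $ i $ k) \<le> x"
  shows "\<exists>G. G ** heat_matrix T H = H \<and> det (heat_matrix T H) \<noteq> 0 \<and>
    (\<forall>a b. (heat_term UNIV T H a b has_sum (exp (bilinear_form G a b) / det (heat_matrix T H))) UNIV)"
  using finite[of A] assms(2-)
proof (induction A arbitrary: T H)
  case empty
  have T: "T = (\<lambda>_. 0)" using empty(1) by auto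
  have "heat_matrix T H = mat 1" by (simp add: heat_matrix_def T mat_def)
  thus ?case using heat_term_has_sum_0[of H] by (intro exI[of _ H]) (simp add: T)
next
  case (insert j A)
  note T = insert.prems(1,2) and H = insert.prems(3)
  define t where "t = T j"
  define T0 where "T0 = T(j := 0)"
  \<comment> \<open>Data for the nonnegative series that dominates: \<open>T1\<close> on \<open>A\<close> and constant entries \<open>x\<close>.\<close>
  define T1 :: "'n \<Rightarrow> real" where "T1 = (\<lambda>i. if i \<in> A then 1 else 0)"
  define X :: "real ^ 'n ^ 'n" where "X = (\<chi> i k. x)"
  define X' :: "complex ^ 'n ^ 'n" where "X' = (\<chi> i k. of_real (X $ i $ k))"
  have x0: "x \<ge> 0" using H[of j j] norm_ge_zero order_trans by blast
  have T_eq: "T = T0(j := t)" by (simp add: T0_def t_def)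
  have T0j: "T0 j = 0" and T0: "norm (T0 i) \<le> 1" for i using T by (simp_all add: T0_def)
  have T1j: "of_real (T1 j) = (0 :: complex)" and T1: "norm (complex_of_real (T1 i)) \<le> 1" for i 
    using insert.hyps by (simp_all add: T1_def)
  have X': "norm (X' $ i $ k) \<le> x" for i k using x0 by (simp add: X'_def X_def)
  obtain G where G: "G ** heat_matrix T0 H = H" "det (heat_matrix T0 H) \<noteq> 0"
      "\<And>a b. (heat_term UNIV T0 H a b has_sum (exp (bilinear_form G a b) / det (heat_matrix T0 H))) UNIV"
  proof -
    have "\<exists>G. G ** heat_matrix T0 H = H \<and> det (heat_matrix T0 H) \<noteq> 0 \<and>
      (\<forall>a b. (heat_term UNIV T0 H a b has_sum (exp (bilinear_form G a b) / det (heat_matrix T0 H))) UNIV)"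
      by (rule insert.IH) (use T T0 H in \<open>auto simp: T0_def\<close>)
    thus ?thesis using that by blast
  qed
  obtain G1 where G1: "G1 ** heat_matrix (\<lambda>i. of_real (T1 i)) X' = X'" "det (heat_matrix (\<lambda>i. of_real (T1 i)) X') \<noteq> 0"
      "\<And>a b. (heat_term UNIV (\<lambda>i. of_real (T1 i)) X' a b has_sum (exp (bilinear_form G1 a b) / det (heat_matrix (\<lambda>i. of_real (T1 i)) X'))) UNIV"
  proof -
    have "\<exists>G. G ** heat_matrix (\<lambda>i. of_real (T1 i)) X' = X' \<and> det (heat_matrix (\<lambda>i. of_real (T1 i)) X') \<noteq> 0 \<and>
      (\<forall>a b. (heat_term UNIV (\<lambda>i. of_real (T1 i)) X' a b has_sum (exp (bilinear_form G a b) / det (heat_matrix (\<lambda>i. of_real (T1 i)) X'))) UNIV)"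
      by (rule insert.IH[OF _ T1 X']) (simp add: T1_def)
    thus ?thesis using that by blast
  qed
  have \<alpha>: "norm (G $ j $ j) < 1"
    using G(1,2) T0j T0 H x by (rule resolvent_entry_bound)
  have \<alpha>1: "norm (G1 $ j $ j) < 1"
    using G1(1,2) T1j T1 X' x by (rule resolvent_entry_bound)
  have t1: "norm t \<le> 1" using T by (simp add: t_def)
  have "norm (t * G $ j $ j) < 1"
    using t1 \<alpha> by (simp add: norm_mult) (metis le_less_trans mult_left_le_one_le norm_ge_zero)
  hence nz: "1 - t * G $ j $ j \<noteq> 0" by auto
  define s where "s = 1 - t * G $ j $ j"
  have det: "det (heat_matrix T H) = s * det (heat_matrix T0 H)"
    unfolding T_eq s_def using G(1) T0j by (rule det_heat_matrix_update)
  define G' :: "complex ^ 'n ^ 'n" where "G' = (\<chi> i k. G $ i $ k + t * G $ i $ j * G $ j $ k / s)"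
  have "G' ** heat_matrix T H = H"
    unfolding T_eq G'_def s_def using G(1) T0j nz by (rule resolvent_update)
  moreover have "det (heat_matrix T H) \<noteq> 0"
    using det G(2) nz by (simp add: s_def)
  moreover have "(heat_term UNIV T H a b has_sum (exp (bilinear_form G' a b) / det (heat_matrix T H))) UNIV" for a b
  proof -
    define \<beta> where "\<beta> = (\<Sum>k\<in>UNIV - {j}. G $ j $ k * b k)"
    define \<gamma> where "\<gamma> = (\<Sum>i\<in>UNIV - {j}. a i * G $ i $ j)"
    define \<delta> where "\<delta> = (\<Sum>i\<in>UNIV - {j}. \<Sum>k\<in>UNIV - {j}. a i * G $ i $ k * b k)"
    define p where "p = heat_term (UNIV - {j}) T0 H a b"
    define p1 where "p1 = heat_term (UNIV - {j}) T1 X (\<lambda>i. norm (a i)) (\<lambda>i. norm (b i))"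
    have p1_nonneg: "p1 K \<ge> 0" for K
      unfolding p1_def using x0 by (intro heat_term_nonneg) (auto simp: T1_def X_def)
    have p_le: "norm (p K) \<le> p1 K" for K
      unfolding p_def p1_def
      by (rule norm_heat_term_le) (use T H in \<open>auto simp: T0_def T1_def X_def\<close>)
    have p1_eq: "heat_term (UNIV - {j}) (\<lambda>i. of_real (T1 i)) X' (\<lambda>i. of_real (norm (a i))) (\<lambda>i. of_real (norm (b i))) = (\<lambda>K. of_real (p1 K))"
      by (simp add: p1_def X'_def heat_term_of_real fun_eq_iff)
    \<comment> \<open>Absolute convergence comes from the induction hypothesis at the dominating data, not at \<open>H\<close>.\<close>
    have "(\<lambda>(K, l). p1 K * (fact l * of_nat (row_sum K j choose l) * of_nat (col_sum K j choose l) * norm (a j) ^ (row_sum K j - l) * norm (b j) ^ (col_sum K j - l)))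
         summable_on (UNIV \<times> UNIV)"
      by (rule heat_sum_summable[OF heat_term_slice[OF G1(3), of j "\<lambda>i. of_real (norm (a i))" "\<lambda>i. of_real (norm (b i))", OF T1j, unfolded p1_eq]])
         (use p1_nonneg \<alpha>1 in auto)
    hence summ: "(\<lambda>(K, l). norm (p K) * (fact l * of_nat (row_sum K j choose l) * of_nat (col_sum K j choose l) * norm (a j) ^ (row_sum K j - l) * norm (b j) ^ (col_sum K j - l)))
         summable_on (UNIV \<times> UNIV)"
      by (rule summable_on_comparison_test) (auto intro!: mult_right_mono p_le)
    have "((\<lambda>K. p K * heat_monomial t (row_sum K j) (col_sum K j) (a j) (b j)) has_sum
       (exp \<delta> / det (heat_matrix T0 H) / (1 - t * G $ j $ j) * exp (G $ j $ j * a j * b j + \<beta> * a j + \<gamma> * b j 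
         + t * ((G $ j $ j * b j + \<beta>) * (G $ j $ j * a j + \<gamma>)) / (1 - t * G $ j $ j)))) UNIV"
      by (rule heat_sum_has_sum[OF _ summ \<alpha> t1]) 
         (use heat_term_slice[OF G(3) T0j, of a b] in \<open>simp add: p_def \<beta>_def \<gamma>_def \<delta>_def\<close>)
    moreover have "p K * heat_monomial t (row_sum K j) (col_sum K j) (a j) (b j) = heat_term UNIV T H a b K" for K
      unfolding heat_term_split[of T H a b K j] p_def t_def
      by (subst heat_term_cong[of "UNIV - {j}" T T0 a a b b]) (simp_all add: T0_def)
    moreover have "bilinear_form G' a b = \<delta> + (G $ j $ j * a j * b j + \<beta> * a j + \<gamma> * b j 
         + t * ((G $ j $ j * b j + \<beta>) * (G $ j $ j * a j + \<gamma>)) / s)"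
    proof -
      have "bilinear_form G a b = G $ j $ j * a j * b j + \<beta> * a j + \<gamma> * b j + \<delta>"
        using bilinear_form_update[of G a j "a j" b "b j"] by (simp add: \<beta>_def \<gamma>_def \<delta>_def)
      moreover have "(\<Sum>k\<in>UNIV. G $ j $ k * b k) = G $ j $ j * b j + \<beta>"
        unfolding \<beta>_def by (simp add: sum.remove)
      moreover have "(\<Sum>i\<in>UNIV. a i * G $ i $ j) = G $ j $ j * a j + \<gamma>"
        unfolding \<gamma>_def by (simp add: sum.remove mult.commute)
      ultimately show ?thesis unfolding G'_def bilinear_form_resolvent_update by simp
    qed
    ultimately show ?thesis
      by (simp add: det exp_add mult_ac flip: s_def)
  qed
  ultimately show ?case by blast
qed

section \<open>Convergence and value of the Hermite series\<close>

lemma max_norm_less_iff: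
  fixes H :: "complex ^ 'n::finite ^ 'n"
  shows "max_norm H < c \<longleftrightarrow> (\<forall>i k. cmod (H $ i $ k) < c)"
  unfolding max_norm_def by (subst Max_less_iff) auto

lemma norm_le_max_norm:
  fixes H :: "complex ^ 'n::finite ^ 'n"
  shows "cmod (H $ i $ k) \<le> max_norm H"
  unfolding max_norm_def by (rule Max_ge) auto

lemma hermite_term_eq_heat_term:
  fixes H :: "complex ^ 'n::finite ^ 'n"
  shows "hermite_term H W K = heat_term UNIV (\<lambda>_. -1) H (\<lambda>j. cnj (W $ j)) (\<lambda>j. W $ j) K"
proof -
  have "hermite2 m n z1 z2 = heat_monomial (-1) m n z1 z2" for m n z1 z2
    by (simp add: hermite2_def heat_monomial_def atLeast0AtMost mult.assoc)
  thus ?thesis by (simp add: hermite_term_def heat_term_def)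
qed

text \<open>The case \<open>T = -1\<close>, \<open>a = cnj W\<close>, \<open>b = W\<close>. It holds throughout the ball, from which the identity on any
polydisc inside the ball follows.\<close>

lemma hermite_term_has_sum:
  fixes H :: "complex ^ 'n::finite ^ 'n"
  assumes "H \<in> max_norm_ball"
  shows "invertible (mat 1 + H)"
    and "(hermite_term H W has_sum 
      (exp (sesq_form (H ** matrix_inv (mat 1 + H)) W) / det (mat 1 + H))) UNIV"
proof -
  have "real CARD('n) * max_norm H < 1"
    using assms by (simp add: max_norm_ball_def field_simps)
  from heat_term_has_sum_exists[OF this, of UNIV "\<lambda>_. -1" H]
  obtain G where G: "G ** heat_matrix (\<lambda>_. -1) H = H" "det (heat_matrix (\<lambda>_. -1) H) \<noteq> 0"
    "\<And>a b. (heat_term UNIV (\<lambda>_. -1) H a b has_sum (exp (bilinear_form G a b) / det (heat_matrix (\<lambda>_. -1) H))) UNIV"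
    by (auto simp: norm_le_max_norm)
  have hm: "heat_matrix (\<lambda>_. -1) H = mat 1 + H"
    by (simp add: heat_matrix_def mat_def vec_eq_iff)
  show inv: "invertible (mat 1 + H)"
    using G(2) by (simp add: hm invertible_det_nz)
  hence "(mat 1 + H) ** matrix_inv (mat 1 + H) = mat 1"
    unfolding matrix_inv_def invertible_def by (rule someI2_ex) blast
  hence "H ** matrix_inv (mat 1 + H) = G"
    using G(1) by (metis hm matrix_mul_assoc matrix_mul_rid)
  moreover have "sesq_form G W = bilinear_form G (\<lambda>j. cnj (W $ j)) (\<lambda>j. W $ j)"
    by (simp add: sesq_form_def bilinear_form_def matrix_vector_mult_def sum_distrib_left mult.assoc)
  ultimately show "(hermite_term H W has_sum 
      (exp (sesq_form (H ** matrix_inv (mat 1 + H)) W) / det (mat 1 + H))) UNIV"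
    using G(3)[of "\<lambda>j. cnj (W $ j)" "\<lambda>j. W $ j"] by (simp add: hm hermite_term_eq_heat_term[abs_def])
qed

text \<open>The majorant of the Weierstrass test is itself an instance of the summation formula, with
\<open>T = 1\<close> and a constant matrix.\<close>

lemma heat_term_majorant_summable:
  assumes "x \<ge> 0" "real CARD('n::finite) * x < 1"
  shows "heat_term UNIV (\<lambda>_. 1) (\<chi> i k. x :: real ^ 'n ^ 'n) (\<lambda>_. R) (\<lambda>_. R) summable_on UNIV"
proof -
  define X :: "real ^ 'n ^ 'n" where "X = (\<chi> i k. x)"
  obtain S where S: "(heat_term UNIV (\<lambda>_. of_real 1) (\<chi> i k. complex_of_real (X $ i $ k)) (\<lambda>_. of_real R) (\<lambda>_. of_real R) has_sum S) UNIV"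
    using heat_term_has_sum_exists[OF assms(2), of UNIV "\<lambda>_. of_real 1" "\<chi> i k. complex_of_real (X $ i $ k)"] assms(1)
    by (auto simp: X_def)
  have "(\<lambda>K. complex_of_real (heat_term UNIV (\<lambda>_. 1) X (\<lambda>_. R) (\<lambda>_. R) K)) summable_on UNIV"
    using has_sum_imp_summable[OF S] unfolding heat_term_of_real[symmetric] .
  from summable_on_Re[OF this] show ?thesis by (simp add: X_def)
qed

text \<open>Compactness is used entry by entry: each entry attains its maximal modulus on \<open>D\<close>, which is therefore
strictly below \<open>1 / N\<close>.\<close>

lemma compact_max_norm_ball_bound:
  fixes D :: "(complex ^ 'n::finite ^ 'n) set"
  assumes D: "compact D" "D \<subseteq> max_norm_ball"
  obtains x where "x \<ge> 0" "real CARD('n) * x < 1" "\<And>H i k. H \<in> D \<Longrightarrow> cmod (H $ i $ k) \<le> x"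
proof -
  have "\<exists>c. 0 \<le> c \<and> c < 1 / real CARD('n) \<and> (\<forall>H\<in>D. cmod (H $ i $ k) \<le> c)" for i k
  proof (cases "D = {}")
    case False
    have "continuous_on D (\<lambda>H. cmod (H $ i $ k))" by (intro continuous_intros)
    from continuous_attains_sup[OF D(1) False this]
    obtain H0 where H0: "H0 \<in> D" "\<forall>H\<in>D. cmod (H $ i $ k) \<le> cmod (H0 $ i $ k)" by blast
    moreover have "cmod (H0 $ i $ k) < 1 / real CARD('n)"
      using H0(1) D(2) by (auto simp: max_norm_ball_def max_norm_less_iff)
    ultimately show ?thesis by (intro exI[of _ "cmod (H0 $ i $ k)"]) auto
  qed (auto intro: exI[of _ 0])
  then obtain c where c: "\<And>i k. 0 \<le> c i k" "\<And>i k. c i k < 1 / real CARD('n)" "\<And>i k H. H \<in> D \<Longrightarrow> cmod (H $ i $ k) \<le> c i k"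
    by metis
  define x where "x = Max (range (\<lambda>(i, k). c i k))"
  have le: "c i k \<le> x" for i k unfolding x_def by (rule Max_ge) auto
  have "x < 1 / real CARD('n)" unfolding x_def by (subst Max_less_iff) (auto simp: c)
  hence "real CARD('n) * x < 1" by (simp add: field_simps)
  moreover have "x \<ge> 0" using c(1) le order_trans by blast
  ultimately show ?thesis using that c(3) le order_trans by blast
qed

text \<open>Off the diagonal \<open>h\<^sub>l\<^sub>k = u + \<i> v\<close> and \<open>h\<^sub>k\<^sub>l = u - \<i> v\<close> with \<open>u\<close> and \<open>v\<close> both below \<open>1 / (2 N)\<close>.\<close>

lemma hpolydisc_0_subset:
  "hpolydisc (0 :: complex ^ 'n::{finite,linorder} ^ 'n::{finite,linorder})
       (\<chi> j k. if j = k then 1 / real CARD('n) else 1 / (2 * real CARD('n))) \<subseteq> max_norm_ball"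
proof
  fix H :: "complex ^ 'n::{finite,linorder} ^ 'n::{finite,linorder}"
  define N where "N = real CARD('n)"
  assume H: "H \<in> hpolydisc 0 (\<chi> j k. if j = k then 1 / real CARD('n) else 1 / (2 * real CARD('n)))"
  have diag: "cmod (H $ j $ j) < 1 / N" for j
    using H by (simp add: hpolydisc_def N_def)
  have off: "cmod (u_part H l k) < 1 / (2 * N) \<and> cmod (v_part H l k) < 1 / (2 * N)" if "l < k" for l k
  proof -
    have "u_part (0 :: complex ^ 'n::{finite,linorder} ^ 'n::{finite,linorder}) l k = 0"
      "v_part (0 :: complex ^ 'n::{finite,linorder} ^ 'n::{finite,linorder}) l k = 0"
      by (simp_all add: u_part_def v_part_def)
    moreover from H have "\<forall>l k. l < k \<longrightarrow>
        cmod (u_part H l k - u_part 0 l k) < (if l = k then 1 / N else 1 / (2 * N)) \<and>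
        cmod (v_part H l k - v_part 0 l k) < (if l = k then 1 / N else 1 / (2 * N))"
      unfolding N_def by (simp add: hpolydisc_def split del: if_split)
    note this[rule_format, OF that]
    ultimately show ?thesis using less_imp_neq[OF that] by simp
  qed
  have "cmod (H $ l $ k) < 1 / N" for l k
  proof -
    have half: "1 / (2 * N) + 1 / (2 * N) = 1 / N" by (simp add: N_def)
    consider "l = k" | "l < k" | "k < l" by fastforce
    thus ?thesis
    proof cases
      case 2
      have "H $ l $ k = u_part H l k + \<i> * v_part H l k"
        by (simp add: u_part_def v_part_def field_simps)
      also have "cmod \<dots> \<le> cmod (u_part H l k) + cmod (v_part H l k)"
        by (rule order_trans[OF norm_triangle_ineq]) (simp add: norm_mult)
      finally show ?thesis using off[OF 2] half by linarith
    next
      case 3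
      have "H $ l $ k = u_part H k l - \<i> * v_part H k l"
        by (simp add: u_part_def v_part_def field_simps)
      also have "cmod \<dots> \<le> cmod (u_part H k l) + cmod (v_part H k l)"
        by (rule order_trans[OF norm_triangle_ineq4]) (simp add: norm_mult)
      finally show ?thesis using off[OF 3] half by linarith
    qed (simp add: diag)
  qed
  thus "H \<in> max_norm_ball" by (simp add: max_norm_ball_def max_norm_less_iff N_def)
qed

lemma hermite_series_uniform:
  fixes C :: "(complex ^ 'n::finite) set" and D :: "(complex ^ 'n ^ 'n) set"
  assumes C: "compact C" and D: "compact D" "D \<subseteq> max_norm_ball"
  shows "W \<in> C \<Longrightarrow> H \<in> D \<Longrightarrow> (\<lambda>K. norm (hermite_term H W K)) summable_on UNIV"
    and "uniform_limit (C \<times> D)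
          (\<lambda>F (W, H). \<Sum>K\<in>F. hermite_term H W K)
          (\<lambda>(W, H). \<Sum>\<^sub>\<infinity>K. hermite_term H W K)
          (finite_subsets_at_top UNIV)"
proof -
  obtain x where x: "x \<ge> 0" "real CARD('n) * x < 1" "\<And>H i k. H \<in> D \<Longrightarrow> cmod (H $ i $ k) \<le> x"
    using compact_max_norm_ball_bound[OF D] by metis
  obtain R where "\<And>W. W \<in> C \<Longrightarrow> norm W \<le> R"
    using compact_imp_bounded[OF C] by (auto simp: bounded_iff)
  hence R: "cmod (W $ j) \<le> R" if "W \<in> C" for W j
    using that Finite_Cartesian_Product.norm_nth_le order_trans by blast
  define M where "M = heat_term UNIV (\<lambda>_. 1) (\<chi> i k. x :: real ^ 'n ^ 'n) (\<lambda>_. R) (\<lambda>_. R)"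
  have M: "M summable_on UNIV"
    unfolding M_def using x(1,2) by (rule heat_term_majorant_summable)
  have le: "norm (hermite_term H W K) \<le> M K" if "W \<in> C" "H \<in> D" for W H K
    unfolding M_def hermite_term_eq_heat_term
    by (rule norm_heat_term_le) (use that x(3) R in auto)
  show "(\<lambda>K. norm (hermite_term H W K)) summable_on UNIV" if "W \<in> C" "H \<in> D"
    by (rule Infinite_Sum.abs_summable_on_comparison_test'[OF M]) (use le that in auto)
  have "uniform_limit (C \<times> D) (\<lambda>F y. \<Sum>K\<in>F. hermite_term (snd y) (fst y) K)
     (\<lambda>y. \<Sum>\<^sub>\<infinity>K. hermite_term (snd y) (fst y) K) (finite_subsets_at_top UNIV)"
    by (rule Weierstrass_m_test_general[OF _ M]) (use le in auto)
  thus "uniform_limit (C \<times> D)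
          (\<lambda>F (W, H). \<Sum>K\<in>F. hermite_term H W K)
          (\<lambda>(W, H). \<Sum>\<^sub>\<infinity>K. hermite_term H W K)
          (finite_subsets_at_top UNIV)"
    unfolding case_prod_beta' .
qed

theorem theorem1p3:
  "(\<forall>(C :: (complex ^ 'n::{finite,linorder}) set) (D :: (complex ^ 'n::{finite,linorder} ^ 'n::{finite,linorder}) set).
      compact C \<and> compact D \<and> D \<subseteq> max_norm_ball \<longrightarrow>
        (\<forall>W\<in>C. \<forall>H\<in>D. (\<lambda>K. norm (hermite_term H W K)) summable_on UNIV) \<and>
        uniform_limit (C \<times> D)
          (\<lambda>F (W, H). \<Sum>K\<in>F. hermite_term H W K)
          (\<lambda>(W, H). \<Sum>\<^sub>\<infinity>K. hermite_term H W K)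
          (finite_subsets_at_top UNIV))
   \<and>
   (\<forall>(\<delta> :: real ^ 'n::{finite,linorder} ^ 'n::{finite,linorder}) (H0 :: complex ^ 'n::{finite,linorder} ^ 'n::{finite,linorder}).
      (\<forall>j k. \<delta> $ j $ k > 0) \<and> H0 \<in> max_norm_ball \<and> hermitian_matrix H0 \<and>
      hpolydisc H0 \<delta> \<subseteq> max_norm_ball \<longrightarrow>
        (\<forall>W. \<forall>H\<in>hpolydisc H0 \<delta>.
           invertible (mat 1 + H) \<and>
           exp (sesq_form (H ** matrix_inv (mat 1 + H)) W)
             = det (mat 1 + H) * (\<Sum>\<^sub>\<infinity>K. hermite_term H W K)))
   \<and>
   hpolydisc (0 :: complex ^ 'n::{finite,linorder} ^ 'n::{finite,linorder})
       (\<chi> j k. if j = k then 1 / real CARD('n) else 1 / (2 * real CARD('n)))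
     \<subseteq> max_norm_ball"
proof (intro conjI allI impI ballI)
  fix C :: "(complex ^ 'n::{finite,linorder}) set" and D :: "(complex ^ 'n::{finite,linorder} ^ 'n::{finite,linorder}) set" and W H
  assume "compact C \<and> compact D \<and> D \<subseteq> max_norm_ball" "W \<in> C" "H \<in> D"
  thus "(\<lambda>K. norm (hermite_term H W K)) summable_on UNIV"
    using hermite_series_uniform(1) by blast
next
  fix C :: "(complex ^ 'n::{finite,linorder}) set" and D :: "(complex ^ 'n::{finite,linorder} ^ 'n::{finite,linorder}) set"
  assume "compact C \<and> compact D \<and> D \<subseteq> max_norm_ball"
  thus "uniform_limit (C \<times> D)
          (\<lambda>F (W, H). \<Sum>K\<in>F. hermite_term H W K)
          (\<lambda>(W, H). \<Sum>\<^sub>\<infinity>K. hermite_term H W K)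
          (finite_subsets_at_top UNIV)"
    using hermite_series_uniform(2) by blast
next
  fix \<delta> :: "real ^ 'n::{finite,linorder} ^ 'n::{finite,linorder}" and H0 H :: "complex ^ 'n::{finite,linorder} ^ 'n::{finite,linorder}" and W :: "complex ^ 'n::{finite,linorder}"
  assume "(\<forall>j k. \<delta> $ j $ k > 0) \<and> H0 \<in> max_norm_ball \<and> hermitian_matrix H0 \<and>
      hpolydisc H0 \<delta> \<subseteq> max_norm_ball" and "H \<in> hpolydisc H0 \<delta>"
  hence H: "H \<in> max_norm_ball" by blast
  show "invertible (mat 1 + H)"
    using H by (rule hermite_term_has_sum(1))
  hence "det (mat 1 + H) \<noteq> 0" by (simp add: invertible_det_nz)
  thus "exp (sesq_form (H ** matrix_inv (mat 1 + H)) W) = det (mat 1 + H) * (\<Sum>\<^sub>\<infinity>K. hermite_term H W K)"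
    using hermite_term_has_sum(2)[OF H, of W] by (simp add: infsumI)
qed (rule hpolydisc_0_subset)

end
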